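(* Let $K$ be a field and let $\Gamma$ be a quiver. The subspace $\theta(K\Gamma)$ of $K[\Gamma]^*$ consists of exactly those $f\in K[\Gamma]^*$ such that $\mathrm{Ker}(f)$ contains a two-sided monomial ideal of $K[\Gamma]$ of finite codimension.
   Context: A quiver $\Gamma=(\Gamma_0,\Gamma_1)$ has a (possibly infinite) set of vertices $\Gamma_0$ and a (possibly infinite) set of arrows $\Gamma_1$; an arrow $a$ goes from its source $s(a)$ to its target $t(a)$. A path of length $n\ge 1$ is a sequence of arrows $p=a_1a_2\cdots a_n$ with $t(a_i)=s(a_{i+1})$, with $s(p)=s(a_1)$, $t(p)=t(a_n)$; vertices $v$ are paths of length $0$ with $s(v)=t(v)=v$. If $t(p)=s(q)$, $pq$ denotes the concatenation. The path coalgebra $K\Gamma$ is the $K$-vector space with basis all paths, with $\Delta(p)=\sum_{qr=p}q\otimes r$ and $\epsilon(v)=1$ for vertices $v$, $\epsilon(p)=0$ for paths of positive length. The quiver algebra $K[\Gamma]$ is the $K$-vector space with basis all paths, with product of paths $p,q$ equal to $pq$ if $t(p)=s(q)$ and $0$ otherwise; it need not have an identity. The linear map $\theta:K\Gamma\to K[\Gamma]^*$ is defined by $\theta(p)(q)=\delta_{p,q}$ for paths $p,q$. A monomial ideal of $K[\Gamma]$ is an ideal which has a $K$-basis consisting of paths. *)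

theory Defs
  imports
    "Graph_Theory.Graph_Theory"
    "HOL-Library.Poly_Mapping"
    "HOL-Library.FuncSet"
begin

text \<open>
  A quiver is a \<^locale>\<open>wf_digraph\<close>: vertex and arc sets may be infinite, and loops and multiple
  arcs are allowed. A path is encoded as a triple (source, list of arrows, target), so that the
  paths of length 0 are the triples (v, [], v) for vertices v.
\<close>

type_synonym ('v, 'a) qpath = "'v \<times> 'a list \<times> 'v"

definition paths :: "('v, 'a) pre_digraph \<Rightarrow> ('v, 'a) qpath set" where
  "paths G = {(u, p, v). pre_digraph.awalk G u p v}"

fun source :: "('v, 'a) qpath \<Rightarrow> 'v" where "source (u, p, v) = u"

fun target :: "('v, 'a) qpath \<Rightarrow> 'v" where "target (u, p, v) = v"

fun concat_path :: "('v, 'a) qpath \<Rightarrow> ('v, 'a) qpath \<Rightarrow> ('v, 'a) qpath" where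
  "concat_path (u, p, v) (u', q, v') = (u, p @ q, v')"

definition scale :: "'k::field \<Rightarrow> ('p \<Rightarrow>\<^sub>0 'k) \<Rightarrow> ('p \<Rightarrow>\<^sub>0 'k)" where
  "scale c x = Poly_Mapping.map ((*) c) x"

lemma lookup_scale [simp]: "Poly_Mapping.lookup (scale c x) p = c * Poly_Mapping.lookup x p"
  by (simp add: scale_def Poly_Mapping.map.rep_eq when_def)

global_interpretation pm: vector_space "scale :: 'k::field \<Rightarrow> ('p \<Rightarrow>\<^sub>0 'k) \<Rightarrow> _"
  by unfold_locales (auto intro!: poly_mapping_eqI simp: lookup_add algebra_simps)

text \<open>
  The vector space with basis the paths of G. It underlies both the path coalgebra and the
  quiver algebra; the map \<open>theta\<close> below does not involve the comultiplication and the counit.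
\<close>

definition path_space :: "('v, 'a) pre_digraph \<Rightarrow> (('v, 'a) qpath \<Rightarrow>\<^sub>0 'k::field) set" where
  "path_space G = {x. Poly_Mapping.keys x \<subseteq> paths G}"

definition path_vec :: "('v, 'a) qpath \<Rightarrow> (('v, 'a) qpath \<Rightarrow>\<^sub>0 'k::field)" where
  "path_vec p = Poly_Mapping.single p 1"

text \<open>The product of the quiver algebra, extended bilinearly from paths.\<close>

definition path_mult ::
  "(('v, 'a) qpath \<Rightarrow>\<^sub>0 'k::field) \<Rightarrow> (('v, 'a) qpath \<Rightarrow>\<^sub>0 'k) \<Rightarrow> (('v, 'a) qpath \<Rightarrow>\<^sub>0 'k)" where
  "path_mult x y =
    (\<Sum>p\<in>Poly_Mapping.keys x. \<Sum>q\<in>Poly_Mapping.keys y.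
      scale (Poly_Mapping.lookup x p * Poly_Mapping.lookup y q)
        (if target p = source q then path_vec (concat_path p q) else 0))"

text \<open>
  The full linear dual. Since the space is a subset of a type, functionals are made
  extensional (arbitrary but fixed outside of the space), so that equality of functionals is
  equality on the space.
\<close>

definition path_dual ::
  "('v, 'a) pre_digraph \<Rightarrow> ((('v, 'a) qpath \<Rightarrow>\<^sub>0 'k::field) \<Rightarrow> 'k) set" where
  "path_dual G = {f \<in> extensional (path_space G).
    (\<forall>x\<in>path_space G. \<forall>y\<in>path_space G. f (x + y) = f x + f y) \<and>
    (\<forall>c. \<forall>x\<in>path_space G. f (scale c x) = c * f x)}"

definition functional_ker ::
  "('v, 'a) pre_digraph \<Rightarrow> ((('v, 'a) qpath \<Rightarrow>\<^sub>0 'k::field) \<Rightarrow> 'k) \<Rightarrow> (('v, 'a) qpath \<Rightarrow>\<^sub>0 'k) set" where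
  "functional_ker G f = {x \<in> path_space G. f x = 0}"

text \<open>The linear extension of \<open>theta p q = (if p = q then 1 else 0)\<close> for paths p, q.\<close>

definition theta ::
  "('v, 'a) pre_digraph \<Rightarrow> (('v, 'a) qpath \<Rightarrow>\<^sub>0 'k::field) \<Rightarrow> ((('v, 'a) qpath \<Rightarrow>\<^sub>0 'k) \<Rightarrow> 'k)" where
  "theta G x = (\<lambda>y\<in>path_space G.
    \<Sum>p\<in>Poly_Mapping.keys x. \<Sum>q\<in>Poly_Mapping.keys y.
      Poly_Mapping.lookup x p * Poly_Mapping.lookup y q * (if p = q then 1 else 0))"

definition two_sided_ideal ::
  "('v, 'a) pre_digraph \<Rightarrow> (('v, 'a) qpath \<Rightarrow>\<^sub>0 'k::field) set \<Rightarrow> bool" where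
  "two_sided_ideal G I \<longleftrightarrow>
    I \<subseteq> path_space G \<and> pm.subspace I \<and>
    (\<forall>x\<in>path_space G. \<forall>y\<in>I. path_mult x y \<in> I \<and> path_mult y x \<in> I)"

definition monomial_ideal ::
  "('v, 'a) pre_digraph \<Rightarrow> (('v, 'a) qpath \<Rightarrow>\<^sub>0 'k::field) set \<Rightarrow> bool" where
  "monomial_ideal G I \<longleftrightarrow>
    two_sided_ideal G I \<and>
    (\<exists>B \<subseteq> path_vec ` paths G. pm.independent B \<and> pm.span B = I)"

text \<open>The quotient by I is spanned by the cosets of finitely many elements.\<close>

definition finite_codim ::
  "('v, 'a) pre_digraph \<Rightarrow> (('v, 'a) qpath \<Rightarrow>\<^sub>0 'k::field) set \<Rightarrow> bool" where
  "finite_codim G I \<longleftrightarrow>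
    (\<exists>B \<subseteq> path_space G. finite B \<and> (\<forall>x\<in>path_space G. \<exists>y\<in>pm.span B. x - y \<in> I))"

lemma path_vec_in_path_space: "p \<in> paths G \<Longrightarrow> path_vec p \<in> path_space G"
  by (simp add: path_vec_def path_space_def)

lemma path_mult_path_vec:
  "path_mult (path_vec p) (path_vec q) =
    (if target p = source q then path_vec (concat_path p q) else 0)"
  by (simp add: path_mult_def path_vec_def)

lemma theta_path_vec:
  "q \<in> paths G \<Longrightarrow> theta G (path_vec p) (path_vec q) = (if p = q then 1 else 0)"
  by (simp add: theta_def path_vec_def path_space_def)

end

theory Submission
  imports Defs
begin

text \<open>
  The functional attached to a combination of paths vanishes on all paths that are not subpaths of
  one of the finitely many paths in its support. A path has finitely many subpaths, and a path that
  extends a non-subpath is again a non-subpath, so the non-subpaths span a monomial ideal of finite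
  codimension. Conversely, a monomial ideal of finite codimension contains all but finitely many
  paths, so a functional that vanishes on it is determined by its values on finitely many paths.
\<close>

section \<open>Subspaces spanned by sets of paths\<close>

definition supported :: "'p set \<Rightarrow> ('p \<Rightarrow>\<^sub>0 'k::field) set" where
  "supported S = {x. Poly_Mapping.keys x \<subseteq> S}"

lemma supported_iff: "x \<in> supported S \<longleftrightarrow> (\<forall>p. p \<notin> S \<longrightarrow> Poly_Mapping.lookup x p = 0)"
  by (auto simp: supported_def in_keys_iff)

lemma lookup_supported: "x \<in> supported S \<Longrightarrow> p \<notin> S \<Longrightarrow> Poly_Mapping.lookup x p = 0"
  by (simp add: supported_iff)

lemma path_space_eq_supported: "path_space G = supported (paths G)"
  by (simp add: path_space_def supported_def)

lemma supported_mono: "S \<subseteq> T \<Longrightarrow> supported S \<subseteq> supported T"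
  by (auto simp: supported_def)

lemma lookup_path_vec: "Poly_Mapping.lookup (path_vec p) q = (if p = q then 1 else 0)"
  by (simp add: path_vec_def lookup_single when_def)

lemma path_vec_in_supported_iff: "path_vec p \<in> supported S \<longleftrightarrow> p \<in> S"
  by (auto simp: supported_def path_vec_def)

lemma inj_path_vec: "inj path_vec"
  by (rule injI) (metis lookup_path_vec zero_neq_one)

lemma subspace_supported: "pm.subspace (supported S)"
  by (auto simp: pm.subspace_def supported_iff lookup_add)

lemma lookup_sum_path_vec:
  assumes "finite A"
  shows "Poly_Mapping.lookup (\<Sum>p\<in>A. scale (c p) (path_vec p)) q = (if q \<in> A then c q else 0)"
  using assms by (simp add: lookup_sum lookup_path_vec if_distrib[of "(*) _"] cong: if_cong)

lemma sum_path_vec: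
  "(\<Sum>p\<in>Poly_Mapping.keys x. scale (Poly_Mapping.lookup x p) (path_vec p)) = x"
  by (rule poly_mapping_eqI) (simp add: lookup_sum_path_vec in_keys_iff)

lemma span_path_vec:
  "pm.span (path_vec ` S) = (supported S :: (('v, 'a) qpath \<Rightarrow>\<^sub>0 'k::field) set)"
proof
  show "pm.span (path_vec ` S) \<subseteq> (supported S :: (('v, 'a) qpath \<Rightarrow>\<^sub>0 'k) set)"
    by (rule pm.span_minimal) (auto simp: path_vec_in_supported_iff subspace_supported)
  show "supported S \<subseteq> (pm.span (path_vec ` S) :: (('v, 'a) qpath \<Rightarrow>\<^sub>0 'k) set)"
  proof
    fix x :: "('v, 'a) qpath \<Rightarrow>\<^sub>0 'k"
    assume "x \<in> supported S"
    then have "(\<Sum>p\<in>Poly_Mapping.keys x. scale (Poly_Mapping.lookup x p) (path_vec p))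
        \<in> pm.span (path_vec ` S)"
      by (intro pm.span_sum pm.span_scale pm.span_base) (auto simp: supported_def)
    then show "x \<in> pm.span (path_vec ` S)"
      by (simp only: sum_path_vec)
  qed
qed

text \<open>Distinct paths have distinct vectors, so removing one path from the family leaves a span
  in which that path has coefficient 0 throughout; its own vector cannot lie there.\<close>

lemma independent_path_vec:
  "pm.independent (path_vec ` S :: (('v, 'a) qpath \<Rightarrow>\<^sub>0 'k::field) set)"
proof
  assume "pm.dependent (path_vec ` S :: (('v, 'a) qpath \<Rightarrow>\<^sub>0 'k) set)"
  then obtain p where "path_vec p \<in> pm.span (path_vec ` S - {path_vec p :: _ \<Rightarrow>\<^sub>0 'k})"
    by (auto simp: pm.dependent_def)
  also have "path_vec ` S - {path_vec p :: _ \<Rightarrow>\<^sub>0 'k} = path_vec ` (S - {p})"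
    by (simp add: image_set_diff inj_path_vec)
  finally show False
    by (simp add: span_path_vec path_vec_in_supported_iff)
qed

section \<open>Monomial ideals and their codimension\<close>

lemma path_mult_in_supported:
  assumes "\<And>p q. p \<in> Poly_Mapping.keys x \<Longrightarrow> q \<in> Poly_Mapping.keys y \<Longrightarrow> target p = source q \<Longrightarrow>
    concat_path p q \<in> S"
  shows "path_mult x y \<in> supported S"
  unfolding path_mult_def
  using assms
  by (intro pm.subspace_sum pm.subspace_scale subspace_supported)
    (auto simp: path_vec_in_supported_iff pm.subspace_0[OF subspace_supported])

lemma concat_path_in_paths:
  assumes "wf_digraph G" "p \<in> paths G" "q \<in> paths G" "target p = source q"
  shows "concat_path p q \<in> paths G"
  using assms by (auto simp: paths_def intro: wf_digraph.awalk_appendI)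

text \<open>The product is bilinear in paths, so absorbing products with arbitrary elements reduces
  to absorbing concatenations of single paths.\<close>

lemma monomial_ideal_supported:
  assumes "S \<subseteq> paths G"
    and "\<And>p q. p \<in> paths G \<Longrightarrow> q \<in> S \<Longrightarrow> target p = source q \<Longrightarrow> concat_path p q \<in> S"
    and "\<And>p q. p \<in> paths G \<Longrightarrow> q \<in> S \<Longrightarrow> target q = source p \<Longrightarrow> concat_path q p \<in> S"
  shows "monomial_ideal G (supported S :: (('v, 'a) qpath \<Rightarrow>\<^sub>0 'k::field) set)"
proof -
  have "two_sided_ideal G (supported S :: (('v, 'a) qpath \<Rightarrow>\<^sub>0 'k) set)"
    unfolding two_sided_ideal_def path_space_eq_supported
    by (intro conjI ballI supported_mono subspace_supported path_mult_in_supported assms)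
      (auto simp: supported_def)
  moreover have "path_vec ` S \<subseteq> (path_vec ` paths G :: (('v, 'a) qpath \<Rightarrow>\<^sub>0 'k) set)"
    using assms(1) by (rule image_mono)
  ultimately show ?thesis
    unfolding monomial_ideal_def using independent_path_vec span_path_vec by blast
qed

text \<open>A basis of path vectors is the image of a set \<open>S\<close> of paths, and its span is
  cut out by a support condition. Questions about the ideal thus become questions about
  \<open>S\<close>.\<close>

lemma monomial_ideal_eq_supported:
  assumes "monomial_ideal G I"
  obtains S where "S \<subseteq> paths G" "I = supported S"
proof -
  obtain B where "B \<subseteq> path_vec ` paths G" "pm.span B = I"
    using assms by (auto simp: monomial_ideal_def)
  then obtain S where "S \<subseteq> paths G" "B = path_vec ` S"
    by (auto simp: subset_image_iff)
  with \<open>pm.span B = I\<close> show thesis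
    by (intro that) (auto simp: span_path_vec)
qed

text \<open>The cosets of the paths outside \<open>S\<close> form a basis of the quotient.\<close>

lemma finite_codim_supported_iff:
  "finite_codim G (supported S :: (('v, 'a) qpath \<Rightarrow>\<^sub>0 'k::field) set) \<longleftrightarrow> finite (paths G - S)"
proof
  assume "finite_codim G (supported S :: (('v, 'a) qpath \<Rightarrow>\<^sub>0 'k) set)"
  then obtain B :: "(('v, 'a) qpath \<Rightarrow>\<^sub>0 'k) set" where "finite B"
    and B: "\<And>x. x \<in> path_space G \<Longrightarrow> \<exists>y\<in>pm.span B. x - y \<in> supported S"
    unfolding finite_codim_def by blast
  \<comment> \<open>Finitely many representatives involve only finitely many paths, and so do all
    their combinations; every path outside \<open>S\<close> is shown to be among these.\<close>
  define U where "U = (\<Union>b\<in>B. Poly_Mapping.keys b)"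
  have "finite U"
    using \<open>finite B\<close> by (simp add: U_def)
  have "B \<subseteq> supported U"
    by (auto simp: U_def supported_def)
  then have span: "pm.span B \<subseteq> supported U"
    by (rule pm.span_minimal) (rule subspace_supported)
  have "paths G - S \<subseteq> U"
  proof
    fix p assume p: "p \<in> paths G - S"
    then obtain y where "y \<in> pm.span B" and y: "path_vec p - y \<in> supported S"
      using B path_vec_in_path_space by blast
    then have "y \<in> supported U"
      using span by blast
    \<comment> \<open>Since \<open>p\<close> is not in \<open>S\<close>, the difference has no
      \<open>p\<close>-term, which forces the coefficient of \<open>y\<close> at \<open>p\<close> to
      be 1.\<close>
    have "Poly_Mapping.lookup (path_vec p - y) p = 0"
      using p by (intro lookup_supported[OF y]) simp
    then have "Poly_Mapping.lookup y p \<noteq> 0"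
      by (simp add: lookup_minus lookup_path_vec)
    then show "p \<in> U"
      using lookup_supported[OF \<open>y \<in> supported U\<close>] by blast
  qed
  then show "finite (paths G - S)"
    using \<open>finite U\<close> by (rule finite_subset)
next
  assume fin: "finite (paths G - S)"
  show "finite_codim G (supported S :: (('v, 'a) qpath \<Rightarrow>\<^sub>0 'k) set)"
    unfolding finite_codim_def
  proof (intro exI[of _ "path_vec ` (paths G - S)"] conjI ballI)
    show "path_vec ` (paths G - S) \<subseteq> path_space G"
      by (auto intro: path_vec_in_path_space)
    show "finite (path_vec ` (paths G - S))"
      using fin by simp
    fix x :: "('v, 'a) qpath \<Rightarrow>\<^sub>0 'k" assume x: "x \<in> path_space G"
    \<comment> \<open>The projection of \<open>x\<close> onto the paths outside \<open>S\<close>; a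
      finite sum by \<open>fin\<close>.\<close>
    define y where
      "y = (\<Sum>p\<in>paths G - S. scale (Poly_Mapping.lookup x p) (path_vec p))"
    have "y \<in> pm.span (path_vec ` (paths G - S))"
      unfolding y_def by (intro pm.span_sum pm.span_scale pm.span_base) auto
    moreover have "x - y \<in> supported S"
      using x fin
      by (auto simp: supported_iff path_space_eq_supported y_def lookup_minus
          lookup_sum_path_vec)
    ultimately show "\<exists>y\<in>pm.span (path_vec ` (paths G - S)). x - y \<in> supported S"
      by blast
  qed
qed

section \<open>Subpaths of a path\<close>

text \<open>The endpoints must be matched explicitly because \<open>concat_path\<close> discards the
  inner ones without comparing them. Initial and final segments are covered by taking
  \<open>a\<close> or \<open>b\<close> of length 0.\<close>

definition subpaths :: "('v, 'a) pre_digraph \<Rightarrow> ('v, 'a) qpath \<Rightarrow> ('v, 'a) qpath set" where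
  "subpaths G p = {q \<in> paths G. \<exists>a\<in>paths G. \<exists>b\<in>paths G.
    target a = source q \<and> target q = source b \<and> concat_path a (concat_path q b) = p}"

lemma subpathsI:
  assumes "q \<in> paths G" "a \<in> paths G" "b \<in> paths G" "target a = source q" "target q = source b"
    and "concat_path a (concat_path q b) = p"
  shows "q \<in> subpaths G p"
  using assms unfolding subpaths_def by blast

lemma source_concat_path [simp]: "source (concat_path p q) = source p"
  by (cases p; cases q) simp

lemma target_concat_path [simp]: "target (concat_path p q) = target q"
  by (cases p; cases q) simp

lemma concat_path_assoc: "concat_path (concat_path p q) r = concat_path p (concat_path q r)"
  by (cases p; cases q; cases r) simp

lemma subpath_refl:
  assumes "wf_digraph G" "p \<in> paths G"
  shows "p \<in> subpaths G p"
proof -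
  obtain u l v where p: "p = (u, l, v)"
    by (cases p)
  have "(u, [], u) \<in> paths G" "(v, [], v) \<in> paths G"
    using assms by (auto simp: p paths_def wf_digraph.awalk_Nil_iff
        intro: wf_digraph.awalk_hd_in_verts wf_digraph.awalk_last_in_verts)
  then show ?thesis
    using assms by (intro subpathsI[of p G "(u, [], u)" "(v, [], v)"]) (simp_all add: p)
qed

text \<open>The factor \<open>p\<close> is absorbed into the outer left factor: a(pq)b = (ap)qb.
  Read contrapositively, extending a non-subpath on the left gives a non-subpath.\<close>

lemma subpath_concat_left:
  assumes "wf_digraph G" "p \<in> paths G" "q \<in> paths G" "target p = source q"
    and "concat_path p q \<in> subpaths G r"
  shows "q \<in> subpaths G r"
proof -
  obtain a b where "a \<in> paths G" "b \<in> paths G" "target a = source p" "target q = source b"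
    "concat_path (concat_path a p) (concat_path q b) = r"
    using assms(5) by (auto simp: subpaths_def concat_path_assoc)
  moreover from this have "concat_path a p \<in> paths G"
    using assms by (intro concat_path_in_paths)
  ultimately show ?thesis
    using assms by (intro subpathsI[of q G "concat_path a p" b]) auto
qed

lemma subpath_concat_right:
  assumes "wf_digraph G" "p \<in> paths G" "q \<in> paths G" "target q = source p"
    and "concat_path q p \<in> subpaths G r"
  shows "q \<in> subpaths G r"
proof -
  obtain a b where "a \<in> paths G" "b \<in> paths G" "target a = source q" "target p = source b"
    "concat_path a (concat_path q (concat_path p b)) = r"
    using assms(5) by (auto simp: subpaths_def concat_path_assoc)
  moreover from this have "concat_path p b \<in> paths G"
    using assms by (intro concat_path_in_paths)
  ultimately show ?thesis
    using assms by (intro subpathsI[of q G a "concat_path p b"]) auto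
qed

text \<open>Together with its mirror image below, this confines the endpoints of subpaths to a
  finite set, although the quiver may have infinitely many vertices.\<close>

lemma awalk_target_cases:
  assumes "pre_digraph.awalk G u p v"
  shows "v \<in> insert u (head G ` set p)"
proof -
  have "pre_digraph.cas G u p v"
    using assms by (simp add: pre_digraph.awalk_def)
  then show ?thesis
    by (induction p arbitrary: u) (auto simp: pre_digraph.cas.simps)
qed

lemma awalk_source_cases:
  assumes "pre_digraph.awalk G u p v"
  shows "u \<in> insert v (tail G ` set p)"
  using assms by (cases p) (auto simp: pre_digraph.awalk_def pre_digraph.cas.simps)

lemma finite_subpaths: "finite (subpaths G p)"
proof -
  obtain u l v where p: "p = (u, l, v)"
    by (cases p)
  \<comment> \<open>The source of a subpath is the target of the segment before it, and its target
    is the source of the segment after it. Bounding the endpoints separately from the arrow list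
    also handles subpaths of length 0.\<close>
  have "subpaths G p \<subseteq> insert u (head G ` set l) \<times>
      {m. set m \<subseteq> set l \<and> length m \<le> length l} \<times> insert v (tail G ` set l)"
  proof
    fix q assume "q \<in> subpaths G p"
    then obtain a s m t b where q: "q = (s, m, t)" "l = a @ m @ b"
      and "pre_digraph.awalk G u a s" "pre_digraph.awalk G t b v"
      by (cases q) (auto simp: subpaths_def paths_def p)
    from this(3,4) have "s \<in> insert u (head G ` set a)" "t \<in> insert v (tail G ` set b)"
      by (auto dest: awalk_target_cases awalk_source_cases)
    then show "q \<in> insert u (head G ` set l) \<times>
        {m. set m \<subseteq> set l \<and> length m \<le> length l} \<times> insert v (tail G ` set l)"
      by (auto simp: q)
  qed
  then show ?thesis
    by (rule finite_subset) (auto simp: finite_lists_length_le)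
qed

section \<open>Functionals and their values on paths\<close>

text \<open>The Kronecker delta collapses the inner sum to one coefficient of \<open>y\<close>,
  which is 0 if \<open>p\<close> is outside the support. In this form linearity in \<open>y\<close>
  is visible.\<close>

lemma theta_eq:
  assumes "y \<in> path_space G"
  shows "theta G x y = (\<Sum>p\<in>Poly_Mapping.keys x. Poly_Mapping.lookup x p * Poly_Mapping.lookup y p)"
  using assms by (auto simp: theta_def if_distrib[of "(*) _"] in_keys_iff cong: if_cong
      intro!: sum.cong)

lemma theta_in_path_dual:
  fixes x :: "('v, 'a) qpath \<Rightarrow>\<^sub>0 'k::field"
  shows "theta G x \<in> path_dual G"
proof -
  have "x + y \<in> path_space G" if "x \<in> path_space G" "y \<in> path_space G"
    for x y :: "('v, 'a) qpath \<Rightarrow>\<^sub>0 'k"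
    using that pm.subspace_add subspace_supported by (metis path_space_eq_supported)
  moreover have "scale c x \<in> path_space G" if "x \<in> path_space G"
    for c and x :: "('v, 'a) qpath \<Rightarrow>\<^sub>0 'k"
    using that pm.subspace_scale subspace_supported by (metis path_space_eq_supported)
  moreover have "theta G x \<in> extensional (path_space G)"
    by (simp add: theta_def)
  ultimately show ?thesis
    by (simp add: path_dual_def theta_eq lookup_add distrib_left sum.distrib sum_distrib_left
        mult.left_commute)
qed

lemma path_dual_eq_sum:
  fixes f :: "(('v, 'a) qpath \<Rightarrow>\<^sub>0 'k::field) \<Rightarrow> 'k"
  assumes f: "f \<in> path_dual G" and x: "x \<in> path_space G"
  shows "f x = (\<Sum>p\<in>Poly_Mapping.keys x. Poly_Mapping.lookup x p * f (path_vec p))"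
proof -
  have add: "f (y + z) = f y + f z" if "y \<in> path_space G" "z \<in> path_space G" for y z
    using f that by (simp add: path_dual_def)
  have scale: "f (scale c y) = c * f y" if "y \<in> path_space G" for c y
    using f that by (simp add: path_dual_def)
  have sub: "pm.subspace (path_space G :: (('v, 'a) qpath \<Rightarrow>\<^sub>0 'k) set)"
    by (simp add: path_space_eq_supported subspace_supported)
  have zero: "f 0 = 0"
    using scale[of 0 0] pm.subspace_0[OF sub] by simp
  \<comment> \<open>Coefficients are decoupled from \<open>x\<close> so that induction on the index
    set applies. As \<open>f\<close> is additive only on \<open>path_space G\<close>, each partial
    sum must be placed there first.\<close>
  have "f (\<Sum>p\<in>A. scale (c p) (path_vec p)) = (\<Sum>p\<in>A. c p * f (path_vec p))"
    if "finite A" "A \<subseteq> paths G" for A c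
    using that
  proof (induction A rule: finite_induct)
    case empty
    show ?case by (simp add: zero)
  next
    case (insert p A)
    have "(\<Sum>p\<in>A. scale (c p) (path_vec p)) \<in> path_space G"
      using insert by (intro pm.subspace_sum sub pm.subspace_scale path_vec_in_path_space) auto
    moreover have "(path_vec p :: _ \<Rightarrow>\<^sub>0 'k) \<in> path_space G"
      using insert by (intro path_vec_in_path_space) auto
    ultimately show ?case
      using insert by (simp add: add scale pm.subspace_scale[OF sub])
  qed
  from this[of "Poly_Mapping.keys x" "Poly_Mapping.lookup x"] show ?thesis
    using x by (simp add: sum_path_vec path_space_def)
qed

section \<open>The two inclusions\<close>

lemma theta_ker_contains_monomial_ideal:
  fixes x :: "('v, 'a) qpath \<Rightarrow>\<^sub>0 'k::field"
  assumes G: "wf_digraph G" and x: "x \<in> path_space G"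
  shows "\<exists>I. monomial_ideal G I \<and> finite_codim G I \<and> I \<subseteq> functional_ker G (theta G x)"
proof -
  define D where "D = (\<Union>p\<in>Poly_Mapping.keys x. subpaths G p)"
  have "paths G - (paths G - D) \<subseteq> D"
    by blast
  moreover have "finite D"
    by (simp add: D_def finite_subpaths)
  ultimately have codim: "finite_codim G (supported (paths G - D) :: (_ \<Rightarrow>\<^sub>0 'k) set)"
    by (simp add: finite_codim_supported_iff finite_subset)
  have ideal: "monomial_ideal G (supported (paths G - D) :: (_ \<Rightarrow>\<^sub>0 'k) set)"
    using G by (intro monomial_ideal_supported)
      (auto simp: D_def intro: concat_path_in_paths subpath_concat_left subpath_concat_right)
  \<comment> \<open>Each path is a subpath of itself, so an element supported off \<open>D\<close>
    has coefficient 0 at every path of \<open>x\<close>, and the pairing vanishes.\<close>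
  have "Poly_Mapping.keys x \<subseteq> D"
    using x by (auto simp: D_def path_space_def intro: subpath_refl[OF G])
  then have "y \<in> functional_ker G (theta G x)" if "y \<in> supported (paths G - D)" for y
  proof -
    have "y \<in> path_space G"
      using that by (auto simp: path_space_eq_supported supported_def)
    moreover have "Poly_Mapping.lookup y p = 0" if "p \<in> Poly_Mapping.keys x" for p
      using that \<open>Poly_Mapping.keys x \<subseteq> D\<close>
      by (intro lookup_supported[OF \<open>y \<in> supported _\<close>]) auto
    ultimately show ?thesis
      by (simp add: functional_ker_def theta_eq)
  qed
  with codim ideal show ?thesis
    by blast
qed

lemma in_range_theta:
  fixes f :: "(('v, 'a) qpath \<Rightarrow>\<^sub>0 'k::field) \<Rightarrow> 'k"
  assumes f: "f \<in> path_dual G"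
    and I: "monomial_ideal G I" "finite_codim G I" "I \<subseteq> functional_ker G f"
  shows "f \<in> theta G ` path_space G"
proof -
  obtain S where "S \<subseteq> paths G" and S: "I = supported S"
    using I(1) by (rule monomial_ideal_eq_supported)
  define T where "T = paths G - S"
  have "finite T"
    using I(2) by (simp add: S T_def finite_codim_supported_iff)
  have vanish: "f (path_vec p) = 0" if "p \<in> S" for p
    using that I(3) path_vec_in_supported_iff[of p S] by (auto simp: S functional_ker_def)
  \<comment> \<open>The coefficients of a preimage must be the values of \<open>f\<close> on paths.
    Finiteness of \<open>T\<close> makes this an element of the path space.\<close>
  define x where "x = (\<Sum>p\<in>T. scale (f (path_vec p)) (path_vec p))"
  have lookup_x: "Poly_Mapping.lookup x p = (if p \<in> T then f (path_vec p) else 0)" for p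
    using \<open>finite T\<close> by (simp add: x_def lookup_sum_path_vec)
  have "x \<in> path_space G"
    by (auto simp: path_space_eq_supported supported_iff lookup_x T_def)
  moreover have "f = theta G x"
  proof (rule extensionalityI)
    show "f \<in> extensional (path_space G)" "theta G x \<in> extensional (path_space G)"
      using f theta_in_path_dual[of G x] by (simp_all add: path_dual_def)
    fix y :: "('v, 'a) qpath \<Rightarrow>\<^sub>0 'k" assume y: "y \<in> path_space G"
    have "f y = (\<Sum>p\<in>Poly_Mapping.keys y. Poly_Mapping.lookup y p * f (path_vec p))"
      using f y by (rule path_dual_eq_sum)
    also have "\<dots> = (\<Sum>p\<in>Poly_Mapping.keys y. Poly_Mapping.lookup x p * Poly_Mapping.lookup y p)"
      using y vanish by (intro sum.cong) (auto simp: lookup_x T_def path_space_def)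
    \<comment> \<open>A summand is nonzero only where the supports of \<open>x\<close> and
      \<open>y\<close> meet, so either support can serve as index set.\<close>
    also have "\<dots> = (\<Sum>p\<in>Poly_Mapping.keys x. Poly_Mapping.lookup x p * Poly_Mapping.lookup y p)"
      by (rule sum.mono_neutral_cong) (auto simp: in_keys_iff)
    also have "\<dots> = theta G x y"
      using y by (simp add: theta_eq)
    finally show "f y = theta G x y" .
  qed
  ultimately show ?thesis
    by blast
qed

theorem proposition3p1:
  fixes G :: "('v, 'a) pre_digraph"
  assumes "wf_digraph G"
  shows "theta G ` (path_space G :: (('v, 'a) qpath \<Rightarrow>\<^sub>0 'k::field) set) =
    {f \<in> path_dual G. \<exists>I. monomial_ideal G I \<and> finite_codim G I \<and> I \<subseteq> functional_ker G f}"
proof (intro equalityI subsetI)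
  fix f assume "f \<in> theta G ` (path_space G :: (('v, 'a) qpath \<Rightarrow>\<^sub>0 'k) set)"
  then show "f \<in> {f \<in> path_dual G. \<exists>I. monomial_ideal G I \<and> finite_codim G I \<and>
      I \<subseteq> functional_ker G f}"
    using theta_ker_contains_monomial_ideal[OF assms] theta_in_path_dual by blast
next
  fix f :: "(('v, 'a) qpath \<Rightarrow>\<^sub>0 'k) \<Rightarrow> 'k"
  assume "f \<in> {f \<in> path_dual G. \<exists>I. monomial_ideal G I \<and> finite_codim G I \<and>
      I \<subseteq> functional_ker G f}"
  then show "f \<in> theta G ` path_space G"
    using in_range_theta by blast
qed

end
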